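(* Let $k$ be a field of characteristic zero and, for $n\ge1$, let $d$ be the Weitzenböck derivation of $k[X]=k[x_0,x_1,\ldots,x_n]$, i.e. the $k$-linear derivation with $d(x_0)=0$, $d(x_i)=x_{i-1}$ for $1\le i\le n$; let $k[X]^d$ be its kernel. Write $t=x_0$. (1) If $n=1$, then $k[X]^d=k[t]$. (2) If $n=2$, then $k[X]^d=k[t,dv]$, where $dv=2t x_2-x_1^2$. (3) If $n=3$, then $k[X]^d=k[t,dv,tr,c]$, where $dv=-2t x_2+x_1^2$, $tr=-3t x_1x_2+3t^2x_3+x_1^3$, $c=-18t x_1x_2x_3+8t x_2^3+9x_3^2t^2+6x_1^3x_3-3x_1^2x_2^2$. (4) If $n=4$, then $k[X]^d=k[t,d_1,d_2,tr_1,tr_2]$, where $d_1=-2t x_2+x_1^2$, $d_2=-2t x_4+2x_1x_3-x_2^2$, $tr_1=-3t x_1x_2+3x_3t^2+x_1^3$, $tr_2=12x_2\,t\,x_4-9x_3^2t-6x_1^2x_4+6x_1x_2x_3-2x_2^3$.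
   Context: $k[f_1,\ldots,f_r]$ denotes the $k$-subalgebra generated by $f_1,\ldots,f_r$. The symbols $dv$, $tr$, $c$, $d_i$, $tr_i$ are names of single polynomials. *)

theory Defs
  imports Complex_Main "HOL-Library.Poly_Mapping"
begin

text \<open>
  Polynomials over \<open>'k\<close> in the variables \<open>x\<^sub>0, x\<^sub>1, \<dots>\<close>: an element of \<open>nat \<Rightarrow>\<^sub>0 nat\<close> is a
  monomial (its exponent vector), and a polynomial maps monomials to coefficients.
\<close>

type_synonym 'k mpoly = "(nat \<Rightarrow>\<^sub>0 nat) \<Rightarrow>\<^sub>0 'k"

definition Const :: "'k::zero \<Rightarrow> 'k mpoly" where
  "Const a = Poly_Mapping.single 0 a"

definition X :: "nat \<Rightarrow> 'k::zero_neq_one mpoly" where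
  "X i = Poly_Mapping.single (Poly_Mapping.single i 1) 1"

text \<open>The polynomial ring in the \<open>n + 1\<close> variables \<open>x\<^sub>0, \<dots>, x\<^sub>n\<close>.\<close>

definition poly_ring :: "nat \<Rightarrow> 'k::zero mpoly set" where
  "poly_ring n = {p. \<forall>m\<in>Poly_Mapping.keys p. Poly_Mapping.keys m \<subseteq> {0..n}}"

definition subalgebra :: "'k::comm_ring_1 mpoly set \<Rightarrow> bool" where
  "subalgebra A \<longleftrightarrow>
     (\<forall>a. Const a \<in> A) \<and> (\<forall>p\<in>A. \<forall>q\<in>A. p + q \<in> A) \<and> (\<forall>p\<in>A. \<forall>q\<in>A. p * q \<in> A)"

definition generated_subalgebra :: "'k::comm_ring_1 mpoly set \<Rightarrow> 'k mpoly set" where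
  "generated_subalgebra S = subalgebra hull S"

text \<open>Derivations of a subalgebra \<open>A\<close>, linear over the coefficients; values outside \<open>A\<close> are
  irrelevant.\<close>

definition derivation_on :: "'k::comm_ring_1 mpoly set \<Rightarrow> ('k mpoly \<Rightarrow> 'k mpoly) \<Rightarrow> bool" where
  "derivation_on A d \<longleftrightarrow>
     (\<forall>p\<in>A. d p \<in> A) \<and>
     (\<forall>p\<in>A. \<forall>q\<in>A. d (p + q) = d p + d q) \<and>
     (\<forall>a. \<forall>p\<in>A. d (Const a * p) = Const a * d p) \<and>
     (\<forall>p\<in>A. \<forall>q\<in>A. d (p * q) = d p * q + p * d q)"

definition weitzenboeck_derivation ::
    "nat \<Rightarrow> ('k::comm_ring_1 mpoly \<Rightarrow> 'k mpoly) \<Rightarrow> bool" where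
  "weitzenboeck_derivation n d \<longleftrightarrow>
     derivation_on (poly_ring n) d \<and> d (X 0) = 0 \<and> (\<forall>i\<in>{1..n}. d (X i) = X (i - 1))"

definition kernel_on :: "'k::comm_ring_1 mpoly set \<Rightarrow> ('k mpoly \<Rightarrow> 'k mpoly) \<Rightarrow> 'k mpoly set" where
  "kernel_on A d = {p \<in> A. d p = 0}"


subsection \<open>Existence and uniqueness of the Weitzenboeck derivation\<close>

lemma mpoly_expand:
  fixes p :: "'k::comm_ring_1 mpoly"
  assumes "finite S" "Poly_Mapping.keys p \<subseteq> S"
  shows "p = (\<Sum>m\<in>S. Poly_Mapping.single m (Poly_Mapping.lookup p m))"
proof (rule poly_mapping_eqI)
  fix k
  have "(\<Sum>m\<in>S. Poly_Mapping.lookup (Poly_Mapping.single m (Poly_Mapping.lookup p m)) k)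
      = (\<Sum>m\<in>S. if m = k then Poly_Mapping.lookup p k else 0)"
    by (rule sum.cong) (auto simp: lookup_single when_def)
  also have "\<dots> = Poly_Mapping.lookup p k"
    using assms by (auto simp: sum.delta not_in_keys_iff_lookup_eq_zero[symmetric])
  finally show "Poly_Mapping.lookup p k
      = Poly_Mapping.lookup (\<Sum>m\<in>S. Poly_Mapping.single m (Poly_Mapping.lookup p m)) k"
    by (simp add: lookup_sum)
qed

lemma poly_ring_induct [consumes 1, case_names single add]:
  fixes p :: "'k::comm_ring_1 mpoly"
  assumes "p \<in> poly_ring n"
    and single: "\<And>m a. Poly_Mapping.keys m \<subseteq> {0..n} \<Longrightarrow> P (Poly_Mapping.single m a)"
    and add: "\<And>p q. p \<in> poly_ring n \<Longrightarrow> q \<in> poly_ring n \<Longrightarrow> P p \<Longrightarrow> P q \<Longrightarrow> P (p + q)"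
  shows "P p"
proof -
  have "(\<Sum>m\<in>S. Poly_Mapping.single m (Poly_Mapping.lookup p m)) \<in> poly_ring n
      \<and> P (\<Sum>m\<in>S. Poly_Mapping.single m (Poly_Mapping.lookup p m))"
    if "finite S" "S \<subseteq> Poly_Mapping.keys p" for S
    using that
  proof (induction S rule: finite_induct)
    case empty
    show ?case using single[of 0 0] by (simp add: poly_ring_def)
  next
    case (insert m S)
    have m: "Poly_Mapping.keys m \<subseteq> {0..n}"
      using insert.prems assms(1) by (auto simp: poly_ring_def)
    let ?s = "Poly_Mapping.single m (Poly_Mapping.lookup p m)"
    let ?r = "\<Sum>m\<in>S. Poly_Mapping.single m (Poly_Mapping.lookup p m)"
    have s: "?s \<in> poly_ring n" using m by (auto simp: poly_ring_def)
    have r: "?r \<in> poly_ring n" "P ?r" using insert by auto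
    have "?s + ?r \<in> poly_ring n"
      using s r(1) keys_add[of ?s ?r] unfolding poly_ring_def by blast
    with add[OF s r(1) single[OF m] r(2)] insert.hyps show ?case by simp
  qed
  from this[of "Poly_Mapping.keys p"] show ?thesis
    using mpoly_expand[of "Poly_Mapping.keys p" p] by simp
qed

lemma subalgebra_poly_ring: "subalgebra (poly_ring n :: 'k::comm_ring_1 mpoly set)"
  unfolding subalgebra_def
proof (intro conjI allI ballI)
  fix a :: 'k show "Const a \<in> poly_ring n" by (auto simp: poly_ring_def Const_def)
next
  fix p q :: "'k mpoly"
  assume "p \<in> poly_ring n" "q \<in> poly_ring n"
  then show "p + q \<in> poly_ring n" using keys_add[of p q] unfolding poly_ring_def by blast
next
  fix p q :: "'k mpoly"
  assume pq: "p \<in> poly_ring n" "q \<in> poly_ring n"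
  show "p * q \<in> poly_ring n" unfolding poly_ring_def
  proof safe
    fix m i assume "m \<in> Poly_Mapping.keys (p * q)" and i: "i \<in> Poly_Mapping.keys m"
    then obtain a b where "a \<in> Poly_Mapping.keys p" "b \<in> Poly_Mapping.keys q" "m = a + b"
      using keys_mult[of p q] by blast
    then show "i \<in> {0..n}" using pq i keys_add[of a b] unfolding poly_ring_def by blast
  qed
qed

lemma poly_ring_sum:
  fixes f :: "'b \<Rightarrow> 'k::comm_ring_1 mpoly"
  shows "(\<And>i. i \<in> I \<Longrightarrow> f i \<in> poly_ring n) \<Longrightarrow> sum f I \<in> poly_ring n"
proof (induction I rule: infinite_finite_induct)
  case (insert x F)
  then show ?case using subalgebra_poly_ring[of n] by (auto simp: subalgebra_def)
qed (auto simp: poly_ring_def)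

definition wmonom :: "nat \<Rightarrow> (nat \<Rightarrow>\<^sub>0 nat) \<Rightarrow> 'k::comm_ring_1 mpoly" where
  "wmonom n m = (\<Sum>i\<in>{1..n}. Poly_Mapping.single
     (m - Poly_Mapping.single i 1 + Poly_Mapping.single (i - 1) 1) (of_nat (Poly_Mapping.lookup m i)))"

definition weitz :: "nat \<Rightarrow> 'k::comm_ring_1 mpoly \<Rightarrow> 'k mpoly" where
  "weitz n p = (\<Sum>m\<in>Poly_Mapping.keys p. Const (Poly_Mapping.lookup p m) * wmonom n m)"

lemma weitz_superset:
  assumes "finite S" "Poly_Mapping.keys p \<subseteq> S"
  shows "weitz n p = (\<Sum>m\<in>S. Const (Poly_Mapping.lookup p m) * wmonom n m)"
  unfolding weitz_def using assms
  by (intro sum.mono_neutral_left) (auto simp: Const_def not_in_keys_iff_lookup_eq_zero)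

lemma weitz_single: "weitz n (Poly_Mapping.single m a) = Const a * wmonom n m"
  using weitz_superset[of "{m}" "Poly_Mapping.single m a" n] by simp

lemma weitz_add: "weitz n (p + q) = weitz n p + weitz n q"
proof -
  let ?S = "Poly_Mapping.keys p \<union> Poly_Mapping.keys q"
  have "weitz n r = (\<Sum>m\<in>?S. Const (Poly_Mapping.lookup r m) * wmonom n m)"
    if "Poly_Mapping.keys r \<subseteq> ?S" for r using that by (intro weitz_superset) auto
  from this[of "p + q"] this[of p] this[of q] show ?thesis
    using keys_add[of p q]
    by (simp add: lookup_add Const_def single_add distrib_right sum.distrib)
qed

lemma wmonom_add:
  "(wmonom n (m + m') :: 'k::comm_ring_1 mpoly) =
     wmonom n m * Poly_Mapping.single m' 1 + Poly_Mapping.single m 1 * wmonom n m'"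
proof -
  have shift: "a + b - Poly_Mapping.single i 1 = (a - Poly_Mapping.single i 1) + b"
    if "Poly_Mapping.lookup a i \<noteq> 0" for a b :: "nat \<Rightarrow>\<^sub>0 nat" and i
    using that
    by (intro poly_mapping_eqI) (auto simp: lookup_add lookup_minus lookup_single when_def)
  let ?s = "\<lambda>a i c. Poly_Mapping.single
    (a - Poly_Mapping.single i 1 + Poly_Mapping.single (i - 1) 1) (of_nat c) :: 'k mpoly"
  have part: "?s (a + b) i (Poly_Mapping.lookup a i)
      = ?s a i (Poly_Mapping.lookup a i) * Poly_Mapping.single b 1" for a b i
    using shift[of a i b] by (cases "Poly_Mapping.lookup a i = 0") (simp_all add: mult_single ac_simps)
  have "?s (m + m') i (Poly_Mapping.lookup (m + m') i)
      = ?s m i (Poly_Mapping.lookup m i) * Poly_Mapping.single m' 1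
        + Poly_Mapping.single m 1 * ?s m' i (Poly_Mapping.lookup m' i)" for i
    using part[of m m' i] part[of m' m i] by (simp add: lookup_add single_add add.commute mult.commute)
  then show ?thesis
    unfolding wmonom_def by (simp only: sum.distrib sum_distrib_left sum_distrib_right)
qed

lemma wmonom_in_poly_ring:
  assumes "Poly_Mapping.keys m \<subseteq> {0..n}"
  shows "(wmonom n m :: 'k::comm_ring_1 mpoly) \<in> poly_ring n"
  unfolding wmonom_def
proof (rule poly_ring_sum)
  fix i assume "i \<in> {1..n}"
  moreover have "Poly_Mapping.keys (m - Poly_Mapping.single i 1) \<subseteq> Poly_Mapping.keys m"
    by (auto simp: in_keys_iff lookup_minus)
  ultimately have "Poly_Mapping.keys
      (m - Poly_Mapping.single i 1 + Poly_Mapping.single (i - 1) 1) \<subseteq> {0..n}"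
    using assms keys_add[of "m - Poly_Mapping.single i 1" "Poly_Mapping.single (i - 1) 1"]
    by (fastforce split: if_splits)
  then show "Poly_Mapping.single (m - Poly_Mapping.single i 1 + Poly_Mapping.single (i - 1) 1)
      (of_nat (Poly_Mapping.lookup m i)) \<in> (poly_ring n :: 'k mpoly set)"
    by (auto simp: poly_ring_def)
qed

lemma weitz_scale: "weitz n (Const a * p) = Const a * weitz n p"
proof -
  have "p \<in> poly_ring (Max (insert 0 (\<Union>m\<in>Poly_Mapping.keys p. Poly_Mapping.keys m)))"
    by (auto simp: poly_ring_def intro!: Max_ge)
  then show ?thesis
    by (induction p rule: poly_ring_induct)
      (simp_all add: weitz_add distrib_left weitz_single Const_def mult_single flip: mult.assoc)
qed

lemma weitz_mult:
  assumes "p \<in> poly_ring n" "q \<in> poly_ring n"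
  shows "weitz n (p * q) = weitz n p * q + p * weitz n q"
  using assms(1)
proof (induction p rule: poly_ring_induct)
  case (single m a)
  show ?case using assms(2)
  proof (induction q rule: poly_ring_induct)
    case (single m' b)
    have split: "Poly_Mapping.single k c = Const c * Poly_Mapping.single k 1" for k and c :: 'a
      by (simp add: Const_def mult_single)
    have "weitz n (Poly_Mapping.single m a * Poly_Mapping.single m' b)
        = Const (a * b) * wmonom n (m + m')"
      by (simp add: mult_single weitz_single)
    also have "\<dots> = Const a * Const b * wmonom n (m + m')"
      by (simp add: Const_def mult_single)
    finally have "weitz n (Poly_Mapping.single m a * Poly_Mapping.single m' b)
        = Const a * Const b * wmonom n (m + m')" .
    moreover have "weitz n (Poly_Mapping.single m a) * Poly_Mapping.single m' b
        = Const a * Const b * (wmonom n m * Poly_Mapping.single m' 1)"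
      by (subst split[of m' b]) (simp only: weitz_single ac_simps)
    moreover have "Poly_Mapping.single m a * weitz n (Poly_Mapping.single m' b)
        = Const a * Const b * (Poly_Mapping.single m 1 * wmonom n m')"
      by (subst split[of m a]) (simp only: weitz_single ac_simps)
    ultimately show ?case by (simp only: wmonom_add distrib_left)
  qed (simp add: weitz_add algebra_simps)
qed (simp add: weitz_add algebra_simps)

lemma weitz_X: "i \<le> n \<Longrightarrow> weitz n (X i) = (if i = 0 then 0 else X (i - 1) :: 'k::comm_ring_1 mpoly)"
proof -
  assume i: "i \<le> n"
  have "wmonom n (Poly_Mapping.single i 1)
      = (\<Sum>j\<in>{1..n}. if j = i then X (i - 1) else 0 :: 'k mpoly)"
    unfolding wmonom_def by (rule sum.cong) (auto simp: X_def lookup_single when_def)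
  then show ?thesis using i by (auto simp: X_def weitz_single Const_def)
qed

lemma weitzenboeck_derivation_weitz:
  "weitzenboeck_derivation n (weitz n :: 'k::comm_ring_1 mpoly \<Rightarrow> 'k mpoly)"
proof -
  have "weitz n p \<in> poly_ring n" if "p \<in> poly_ring n" for p :: "'k mpoly"
    unfolding weitz_def
  proof (rule poly_ring_sum)
    fix m assume "m \<in> Poly_Mapping.keys p"
    with that have "(wmonom n m :: 'k mpoly) \<in> poly_ring n"
      by (intro wmonom_in_poly_ring) (auto simp: poly_ring_def)
    then show "Const (Poly_Mapping.lookup p m) * wmonom n m \<in> poly_ring n"
      using subalgebra_poly_ring[of n, where 'k = 'k] unfolding subalgebra_def by blast
  qed
  then show ?thesis
    unfolding weitzenboeck_derivation_def derivation_on_def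
    by (simp add: weitz_add weitz_scale weitz_mult weitz_X)
qed

lemma weitzenboeck_derivation_unique:
  fixes d d' :: "'k::comm_ring_1 mpoly \<Rightarrow> 'k mpoly"
  assumes d: "weitzenboeck_derivation n d" and d': "weitzenboeck_derivation n d'"
    and p: "p \<in> poly_ring n"
  shows "d p = d' p"
proof -
  note defs = weitzenboeck_derivation_def derivation_on_def
  have plus: "e (p + q) = e p + e q" and mult: "e (p * q) = e p * q + p * e q"
    and scale: "e (Const a * p) = Const a * e p"
    if "weitzenboeck_derivation n e" "p \<in> poly_ring n" "q \<in> poly_ring n" for e p q a
    using that unfolding defs by blast+
  have R1: "(1 :: 'k mpoly) \<in> poly_ring n" by (simp add: poly_ring_def)
  have one: "e 1 = 0" if "weitzenboeck_derivation n e" for e :: "'k mpoly \<Rightarrow> 'k mpoly"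
  proof -
    have "e (1 * 1) = e 1 * 1 + 1 * e 1" using that R1 unfolding defs by blast
    then show ?thesis by simp
  qed
  have mono: "d (Poly_Mapping.single m 1) = d' (Poly_Mapping.single m 1)"
    if "Poly_Mapping.keys m \<subseteq> {0..n}" for m
    using that
  proof (induction "\<Sum>i\<le>n. Poly_Mapping.lookup m i" arbitrary: m rule: less_induct)
    case less
    show ?case
    proof (cases "m = 0")
      case True
      then show ?thesis using one[OF d] one[OF d'] by simp
    next
      case False
      then obtain i where i: "Poly_Mapping.lookup m i \<noteq> 0"
        by (metis lookup_zero poly_mapping_eqI)
      then have i_n: "i \<le> n" using less.prems by (meson atLeastAtMost_iff in_keys_iff subsetD)
      define m' where "m' = m - Poly_Mapping.single i 1"
      have m: "m = Poly_Mapping.single i 1 + m'"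
        using i unfolding m'_def
        by (intro poly_mapping_eqI) (auto simp: lookup_add lookup_minus lookup_single when_def)
      have k: "Poly_Mapping.keys m' \<subseteq> {0..n}"
        using less.prems unfolding m'_def by (auto simp: in_keys_iff lookup_minus)
      have "(\<Sum>j\<le>n. Poly_Mapping.lookup m' j) < (\<Sum>j\<le>n. Poly_Mapping.lookup m j)"
        using i i_n by (intro sum_strict_mono_ex1) (auto simp: m'_def lookup_minus intro!: bexI[of _ i])
      from less.hyps[OF this k]
      have IH: "d (Poly_Mapping.single m' 1) = d' (Poly_Mapping.single m' 1)" .
      have s: "Poly_Mapping.single m 1 = X i * (Poly_Mapping.single m' 1 :: 'k mpoly)"
        by (subst m) (simp add: X_def mult_single)
      have X: "(X i :: 'k mpoly) \<in> poly_ring n" "(Poly_Mapping.single m' 1 :: 'k mpoly) \<in> poly_ring n"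
        using i_n k by (auto simp: poly_ring_def X_def)
      have "d (X i) = d' (X i)" using d d' i_n unfolding defs by (cases "i = 0") auto
      then show ?thesis by (simp only: s mult[OF d X] mult[OF d' X] IH)
    qed
  qed
  show ?thesis using p
  proof (induction p rule: poly_ring_induct)
    case (single m a)
    have s: "Poly_Mapping.single m a = Const a * (Poly_Mapping.single m 1 :: 'k mpoly)"
      by (simp add: Const_def mult_single)
    have p: "(Poly_Mapping.single m 1 :: 'k mpoly) \<in> poly_ring n"
      using single by (auto simp: poly_ring_def)
    show ?case by (subst (1 2) s) (simp only: scale[OF d p p] scale[OF d' p p] mono[OF single])
  next
    case (add p q)
    then show ?case by (simp add: plus[OF d] plus[OF d'])
  qed
qed

end

theory Submission
  imports Defs "HOL-Computational_Algebra.Polynomial"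
begin

text \<open>
  Write \<open>t = x\<^sub>0\<close>, \<open>K\<close> for the kernel and \<open>B\<close> for the subalgebra generated by the listed
  polynomials. That \<open>B \<subseteq> K\<close> is a computation with the Leibniz rule; the content is \<open>K \<subseteq> B\<close>, which
  has two halves.

  \<^emph>\<open>After inverting \<open>t\<close>.\<close> Since \<open>d x\<^sub>1 = t\<close> lies in the kernel, \<open>x\<^sub>1\<close> behaves like the variable
  of a polynomial ring over \<open>K\<close> on which \<open>d\<close> acts as \<open>t \<partial>/\<partial>x\<^sub>1\<close>: it is transcendental over \<open>K\<close>,
  and in characteristic zero a polynomial in \<open>x\<^sub>1\<close> over \<open>K\<close> that \<open>d\<close> kills is constant
  (\<open>kernel_poly_slice\<close>). The listed generators express every \<open>x\<^sub>i\<close> as an element of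
  \<open>B[x\<^sub>1]\<close> up to powers of \<open>t\<close>. Hence each \<open>f \<in> K\<close> satisfies \<open>t\<^sup>m f \<in> B\<close> for some \<open>m\<close>.

  \<^emph>\<open>Removing the powers of \<open>t\<close>.\<close> It remains to see that \<open>t f \<in> B\<close> implies \<open>f \<in> B\<close>. This holds if
  \<open>B = M + t B\<close> for a space \<open>M\<close> on which reduction modulo \<open>t\<close> is injective. Injectivity
  follows if even the coarser reduction that also puts \<open>x\<^sub>2 = 0\<close> is injective on \<open>M\<close>, and under
  this reduction all generators other than \<open>t\<close> become scalar multiples of monomials, namely of \<open>x\<^sub>1\<^sup>2\<close>, \<open>x\<^sub>1\<^sup>3\<close> and (\<open>n = 3\<close>) \<open>x\<^sub>1\<^sup>3x\<^sub>3\<close> or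
  (\<open>n = 4\<close>) \<open>x\<^sub>1x\<^sub>3\<close>, \<open>x\<^sub>1\<^sup>2x\<^sub>4\<close>. The only coincidence among products of these monomials is
  \<open>(x\<^sub>1\<^sup>2)\<^sup>3 = (x\<^sub>1\<^sup>3)\<^sup>2\<close>, and it lifts to an identity in \<open>B\<close>, because
  \<open>tr\<^sup>2 - dv\<^sup>3 = t\<^sup>2 c\<close> for \<open>n = 3\<close>, and \<open>tr\<^sub>1\<^sup>2 - d\<^sub>1\<^sup>3 = t\<^sup>2 (3 d\<^sub>1 d\<^sub>2 - t tr\<^sub>2)\<close> for
  \<open>n = 4\<close>. So \<open>M\<close> can be spanned by the products in which the cubic generator occurs at most once
  (\<open>cusp_products\<close>, \<open>saturated_if_monomial_fibre\<close>). For \<open>n \<le> 2\<close> there is no cubic generator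
  and no coincidence: \<open>dv\<close> becomes \<open>-x\<^sub>1\<^sup>2\<close> modulo \<open>t\<close>.
\<close>

section \<open>Subalgebras\<close>

lemma
  assumes "subalgebra A"
  shows subalgebra_Const: "Const a \<in> A"
    and subalgebra_add: "p \<in> A \<Longrightarrow> q \<in> A \<Longrightarrow> p + q \<in> A"
    and subalgebra_mult: "p \<in> A \<Longrightarrow> q \<in> A \<Longrightarrow> p * q \<in> A"
  using assms by (auto simp: subalgebra_def)

lemma subalgebra_zero: "subalgebra A \<Longrightarrow> 0 \<in> A"
  using subalgebra_Const[of A 0] by (simp add: Const_def)

lemma subalgebra_one: "subalgebra A \<Longrightarrow> 1 \<in> A"
  using subalgebra_Const[of A 1] by (simp add: Const_def)

lemma subalgebra_numeral: "subalgebra A \<Longrightarrow> numeral k \<in> A"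
  using subalgebra_Const[of A "numeral k"] by (simp add: Const_def)

lemma subalgebra_of_nat: "subalgebra A \<Longrightarrow> of_nat k \<in> A"
  using subalgebra_Const[of A "of_nat k"] by (simp add: Const_def)

lemma Const_mult_single: "Const a * Poly_Mapping.single m b = Poly_Mapping.single m (a * b)"
  by (simp add: Const_def mult_single)

lemma Const_minus_one: "Const (- 1) = (- 1 :: 'k::comm_ring_1 mpoly)"
  by (simp add: Const_def single_uminus)

lemma subalgebra_uminus: "subalgebra A \<Longrightarrow> p \<in> A \<Longrightarrow> - p \<in> A"
  using subalgebra_mult[of A "Const (- 1)" p] subalgebra_Const[of A "- 1"]
  by (simp add: Const_minus_one)

lemma subalgebra_diff: "subalgebra A \<Longrightarrow> p \<in> A \<Longrightarrow> q \<in> A \<Longrightarrow> p - q \<in> A"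
  using subalgebra_add[of A p "- q"] subalgebra_uminus[of A q] by simp

lemma subalgebra_power: "subalgebra A \<Longrightarrow> p \<in> A \<Longrightarrow> p ^ k \<in> A"
  by (induction k) (auto intro: subalgebra_one subalgebra_mult)

lemma subalgebra_sum: "subalgebra A \<Longrightarrow> (\<And>i. i \<in> I \<Longrightarrow> f i \<in> A) \<Longrightarrow> sum f I \<in> A"
  by (induction I rule: infinite_finite_induct) (auto intro: subalgebra_zero subalgebra_add)

lemmas subalgebra_intros = subalgebra_Const subalgebra_add subalgebra_mult subalgebra_zero
  subalgebra_one subalgebra_numeral subalgebra_of_nat subalgebra_uminus subalgebra_diff
  subalgebra_power

lemma subalgebra_poly:
  assumes "subalgebra A" "x \<in> A" "\<And>i. coeff q i \<in> A"
  shows "poly q x \<in> A"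
  using assms by (auto simp: poly_altdef intro!: subalgebra_sum subalgebra_mult subalgebra_power)

lemma subalgebra_generated: "subalgebra (generated_subalgebra S)"
  unfolding generated_subalgebra_def
  by (rule hull_in) (auto simp: subalgebra_def)

lemma generated_base: "p \<in> S \<Longrightarrow> p \<in> generated_subalgebra S"
  unfolding generated_subalgebra_def by (rule hull_inc)

lemma generated_minimal: "S \<subseteq> A \<Longrightarrow> subalgebra A \<Longrightarrow> generated_subalgebra S \<subseteq> A"
  unfolding generated_subalgebra_def by (rule hull_minimal)

text \<open>A nonzero numeral can be cancelled because its inverse is among the constants.\<close>

lemma subalgebra_cancel_numeral:
  fixes f :: "'k::field_char_0 mpoly"
  assumes "subalgebra A" "numeral k * f \<in> A"
  shows "f \<in> A"
proof -
  have "Const (inverse (numeral k)) * numeral k = (1 :: 'k mpoly)"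
    by (simp add: Const_def mult_single flip: single_numeral single_one)
  then have "f = Const (inverse (numeral k)) * (numeral k * f)"
    by (simp flip: mult.assoc)
  then show ?thesis
    using assms by (metis subalgebra_Const subalgebra_mult)
qed

lemma X_power: "X i ^ k = Poly_Mapping.single (Poly_Mapping.single i k) (1 :: 'k::comm_ring_1)"
  by (induction k) (simp_all add: X_def mult_single flip: single_add)

lemma X_in_poly_ring: "i \<le> n \<Longrightarrow> (X i :: 'k::comm_ring_1 mpoly) \<in> poly_ring n"
  by (auto simp: X_def poly_ring_def)

lemma poly_ring_subset:
  fixes A :: "'k::comm_ring_1 mpoly set"
  assumes A: "subalgebra A" and X: "\<And>i. i \<le> n \<Longrightarrow> X i \<in> A"
  shows "poly_ring n \<subseteq> A"
proof
  fix p :: "'k mpoly" assume "p \<in> poly_ring n"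
  then show "p \<in> A"
  proof (induction p rule: poly_ring_induct)
    case (single m a)
    have m: "m = (\<Sum>i\<le>n. Poly_Mapping.single i (Poly_Mapping.lookup m i))"
    proof (rule poly_mapping_eqI)
      fix j
      have "j \<le> n" if "Poly_Mapping.lookup m j \<noteq> 0"
        using that single by (auto simp: in_keys_iff subset_eq)
      then show "Poly_Mapping.lookup m j
          = Poly_Mapping.lookup (\<Sum>i\<le>n. Poly_Mapping.single i (Poly_Mapping.lookup m i)) j"
        by (auto simp: lookup_sum lookup_single when_def)
    qed
    have "Poly_Mapping.single (\<Sum>i\<in>I. Poly_Mapping.single i (Poly_Mapping.lookup m i)) 1 \<in> A"
      if "finite I" "I \<subseteq> {..n}" for I
      using that
    proof (induction I rule: finite_induct)
      case empty
      then show ?case using subalgebra_one[OF A] by simp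
    next
      case (insert j I)
      have "X j ^ Poly_Mapping.lookup m j *
          Poly_Mapping.single (\<Sum>i\<in>I. Poly_Mapping.single i (Poly_Mapping.lookup m i)) 1 \<in> A"
        using insert by (intro subalgebra_mult[OF A] subalgebra_power[OF A] X) auto
      then show ?case
        using insert.hyps by (simp add: X_power mult_single)
    qed
    from this[of "{..n}"] have "Poly_Mapping.single m 1 \<in> A"
      using m by simp
    from subalgebra_mult[OF A subalgebra_Const[OF A] this] show ?case
      by (simp add: Const_mult_single)
  qed (rule subalgebra_add[OF A])
qed

section \<open>The kernel of a derivation with a slice up to localization\<close>

locale weitzenboeck =
  fixes n :: nat and d :: "'k::field_char_0 mpoly \<Rightarrow> 'k mpoly"
  assumes weitz: "weitzenboeck_derivation n d" and n: "n \<ge> 1"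
begin

abbreviation R :: "'k mpoly set" where "R \<equiv> poly_ring n"
abbreviation K :: "'k mpoly set" where "K \<equiv> kernel_on (poly_ring n) d"

lemmas R_intros = subalgebra_intros[OF subalgebra_poly_ring]

lemma d_add: "p \<in> R \<Longrightarrow> q \<in> R \<Longrightarrow> d (p + q) = d p + d q"
  and d_Const_mult: "p \<in> R \<Longrightarrow> d (Const a * p) = Const a * d p"
  and d_mult: "p \<in> R \<Longrightarrow> q \<in> R \<Longrightarrow> d (p * q) = d p * q + p * d q"
  using weitz unfolding weitzenboeck_derivation_def derivation_on_def by blast+

lemma d_X0: "d (X 0) = 0"
  and d_X: "1 \<le> i \<Longrightarrow> i \<le> n \<Longrightarrow> d (X i) = X (i - 1)"
  using weitz unfolding weitzenboeck_derivation_def by auto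

lemma d_one: "d 1 = 0"
  using d_mult[OF R_intros(5) R_intros(5)] by simp

lemma d_Const: "d (Const a) = 0"
  using d_Const_mult[OF R_intros(5), of a] by (simp add: d_one)

lemma d_numeral: "d (numeral k) = 0"
  using d_Const[of "numeral k"] by (simp add: Const_def)

lemma d_zero: "d 0 = 0"
  using d_Const[of 0] by (simp add: Const_def)

lemma d_uminus: "p \<in> R \<Longrightarrow> d (- p) = - d p"
  using d_Const_mult[of p "- 1"] by (simp add: Const_minus_one)

lemma d_diff: "p \<in> R \<Longrightarrow> q \<in> R \<Longrightarrow> d (p - q) = d p - d q"
  using d_add[of p "- q"] by (simp add: d_uminus R_intros)

lemmas d_simps = d_add d_mult d_numeral d_uminus d_diff d_X0 d_X

lemma subalgebra_kernel: "subalgebra K"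
  by (auto simp: subalgebra_def kernel_on_def d_add d_mult d_Const intro: R_intros)

text \<open>By the Leibniz rule, on polynomials in \<open>x\<close> with coefficients in the kernel, \<open>d\<close> is \<open>d x\<close> times formal
  differentiation.\<close>

lemma d_poly:
  assumes "x \<in> R" "\<And>i. coeff q i \<in> K"
  shows "d (poly q x) = d x * poly (pderiv q) x"
  using assms(2)
proof (induction q)
  case 0
  then show ?case by (simp add: d_zero)
next
  case (pCons a q)
  have q: "coeff q i \<in> K" for i
    using pCons.prems[of "Suc i"] by simp
  then have "poly q x \<in> R"
    by (intro subalgebra_poly[OF subalgebra_poly_ring assms(1)]) (auto simp: kernel_on_def)
  moreover have "a \<in> R" "d a = 0"
    using pCons.prems[of 0] by (auto simp: kernel_on_def)
  ultimately show ?case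
    using assms(1) pCons.IH[OF q]
    by (simp add: d_add d_mult R_intros pderiv_pCons algebra_simps)
qed

lemma coeff_pderiv_kernel: "(\<And>i. coeff q i \<in> K) \<Longrightarrow> coeff (pderiv q) i \<in> K"
  by (auto simp: coeff_pderiv
      intro!: subalgebra_intros(3,7)[OF subalgebra_kernel] simp del: of_nat_Suc)

lemma X0_nonzero: "X 0 \<noteq> (0 :: 'k mpoly)"
  by (metis X_def lookup_single_eq lookup_zero zero_neq_one)

lemma d_poly_X1:
  assumes "\<And>i. coeff q i \<in> K"
  shows "d (poly q (X 1)) = X 0 * poly (pderiv q) (X 1)"
  using d_poly[OF X_in_poly_ring[OF n] assms] d_X[of 1] n by simp

text \<open>A relation for \<open>x\<^sub>1\<close> over the kernel would give, on applying \<open>d\<close> and cancelling \<open>x\<^sub>0\<close>, one of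
  smaller degree.\<close>

lemma X1_transcendental:
  assumes "\<And>i. coeff q i \<in> K" "poly q (X 1) = 0"
  shows "q = 0"
  using assms
proof (induction "degree q" arbitrary: q rule: less_induct)
  case less
  have "X 0 * poly (pderiv q) (X 1) = 0"
    using d_poly_X1[OF less.prems(1)] less.prems(2) d_zero by simp
  then have "poly (pderiv q) (X 1) = 0"
    using X0_nonzero by simp
  show ?case
  proof (cases "degree q = 0")
    case True
    then show ?thesis
      using less.prems(2) by (auto elim: degree_eq_zeroE)
  next
    case False
    then have "pderiv q = 0"
      using less.hyps[of "pderiv q"] coeff_pderiv_kernel[OF less.prems(1)]
        \<open>poly (pderiv q) (X 1) = 0\<close> by (simp add: degree_pderiv)
    with False show ?thesis by (simp add: pderiv_eq_0_iff)
  qed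
qed

lemma kernel_poly_slice:
  assumes q: "\<And>i. coeff q i \<in> K" and "d (poly q (X 1)) = 0"
  shows "poly q (X 1) = coeff q 0"
proof -
  have "poly (pderiv q) (X 1) = 0"
    using d_poly_X1[OF q] assms(2) X0_nonzero by simp
  then have "pderiv q = 0"
    using X1_transcendental[of "pderiv q"] coeff_pderiv_kernel[OF q] by blast
  then obtain a where "q = [:a:]"
    by (auto simp: pderiv_eq_0_iff elim: degree_eq_zeroE)
  then show ?thesis by simp
qed

text \<open>The two halves of the argument, combined. The condition \<open>gen\<close> says that the algebra generated
  by \<open>S\<close> and \<open>x\<^sub>1\<close> becomes the full polynomial ring once \<open>x\<^sub>0\<close> is inverted: any subalgebra
  containing them and closed under division by \<open>x\<^sub>0\<close> contains all variables.\<close>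

lemma kernel_eq_generated:
  assumes S: "S \<subseteq> K"
    and gen: "\<And>A i. subalgebra A \<Longrightarrow> S \<subseteq> A \<Longrightarrow> X 1 \<in> A \<Longrightarrow> (\<And>f. X 0 * f \<in> A \<Longrightarrow> f \<in> A) \<Longrightarrow> i \<le> n
      \<Longrightarrow> X i \<in> A"
    and t: "X 0 \<in> S"
    and saturated: "\<And>f. X 0 * f \<in> generated_subalgebra S \<Longrightarrow> f \<in> generated_subalgebra S"
  shows "K = generated_subalgebra S"
proof
  let ?B = "generated_subalgebra S"
  note B = subalgebra_generated[of S]
  show BK: "?B \<subseteq> K"
    using S subalgebra_kernel by (rule generated_minimal)
  have t_B: "X 0 \<in> ?B" using t by (rule generated_base)
  \<comment> \<open>\<open>C = B[x\<^sub>1]\<close>, and \<open>L\<close> below consists of the elements that a power of \<open>x\<^sub>0\<close> moves into \<open>C\<close>.\<close>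
  define C where "C = {poly q (X 1) | q. \<forall>i. coeff q i \<in> ?B}"
  have B_C: "?B \<subseteq> C"
  proof
    fix b assume "b \<in> ?B"
    then have "\<forall>i. coeff [:b:] i \<in> ?B"
      using subalgebra_zero[OF B] by (simp add: coeff_pCons split: nat.split)
    then show "b \<in> C" unfolding C_def by force
  qed
  have C: "subalgebra C"
    unfolding subalgebra_def
  proof (intro conjI allI ballI)
    show "Const a \<in> C" for a using B_C subalgebra_Const[OF B] by blast
  next
    fix p q assume "p \<in> C" "q \<in> C"
    then obtain p' q' where pq: "p = poly p' (X 1)" "q = poly q' (X 1)"
      "\<And>i. coeff p' i \<in> ?B" "\<And>i. coeff q' i \<in> ?B" unfolding C_def by auto
    have "p + q = poly (p' + q') (X 1) \<and> (\<forall>i. coeff (p' + q') i \<in> ?B)"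
      using pq by (simp add: subalgebra_add[OF B])
    then show "p + q \<in> C" unfolding C_def by blast
    have "p * q = poly (p' * q') (X 1) \<and> (\<forall>i. coeff (p' * q') i \<in> ?B)"
      using pq by (simp add: coeff_mult subalgebra_sum[OF B] subalgebra_mult[OF B])
    then show "p * q \<in> C" unfolding C_def by blast
  qed
  have X1_C: "X 1 \<in> C"
  proof -
    have "(X 1 :: 'k mpoly) = poly [:0, 1:] (X 1) \<and> (\<forall>i. coeff [:0, 1:] i \<in> ?B)"
      using subalgebra_zero[OF B] subalgebra_one[OF B]
      by (simp add: coeff_pCons split: nat.split)
    then show ?thesis unfolding C_def by blast
  qed
  define L where "L = {f. \<exists>m. X 0 ^ m * f \<in> C}"
  have t_pow: "X 0 ^ m \<in> C" for m
    using B_C t_B subalgebra_power[OF C] by blast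
  have C_L: "C \<subseteq> L"
  proof
    fix f assume "f \<in> C"
    then have "X 0 ^ 0 * f \<in> C" by simp
    then show "f \<in> L" unfolding L_def by blast
  qed
  have L: "subalgebra L"
    unfolding subalgebra_def
  proof (intro conjI allI ballI)
    show "Const a \<in> L" for a using C_L subalgebra_Const[OF C] by blast
  next
    fix p q assume "p \<in> L" "q \<in> L"
    then obtain i j where ij: "X 0 ^ i * p \<in> C" "X 0 ^ j * q \<in> C" unfolding L_def by auto
    have "X 0 ^ (i + j) * (p + q) = X 0 ^ j * (X 0 ^ i * p) + X 0 ^ i * (X 0 ^ j * q)"
      by (simp add: power_add algebra_simps)
    also have "\<dots> \<in> C"
      using ij subalgebra_mult[OF C t_pow] by (intro subalgebra_add[OF C]) blast+
    finally show "p + q \<in> L" unfolding L_def by blast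
    have "X 0 ^ (i + j) * (p * q) = (X 0 ^ i * p) * (X 0 ^ j * q)"
      by (simp add: power_add algebra_simps)
    also have "\<dots> \<in> C" using ij by (rule subalgebra_mult[OF C])
    finally show "p * q \<in> L" unfolding L_def by blast
  qed
  have L_sat: "f \<in> L" if "X 0 * f \<in> L" for f
  proof -
    from that obtain m where "X 0 ^ m * (X 0 * f) \<in> C" unfolding L_def by blast
    then have "X 0 ^ Suc m * f \<in> C" by (simp add: ac_simps)
    then show ?thesis unfolding L_def by blast
  qed
  have "S \<subseteq> L" using generated_base[of _ S] B_C C_L by blast
  then have R_L: "R \<subseteq> L"
    using poly_ring_subset[OF L gen[OF L _ subsetD[OF C_L X1_C] L_sat]] by blast
  have descend: "f \<in> ?B" if "X 0 ^ m * f \<in> ?B" for m f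
    using that
  proof (induction m)
    case (Suc m)
    then have "X 0 * (X 0 ^ m * f) \<in> ?B" by (simp add: ac_simps)
    then show ?case using Suc.IH saturated by blast
  qed simp
  show "K \<subseteq> ?B"
  proof
    fix f assume f: "f \<in> K"
    then obtain m where "X 0 ^ m * f \<in> C" using R_L by (auto simp: kernel_on_def L_def)
    then obtain q where q: "X 0 ^ m * f = poly q (X 1)" "\<And>i. coeff q i \<in> ?B"
      unfolding C_def by auto
    have "X 0 ^ m * f \<in> K"
      using f t S by (intro subalgebra_intros[OF subalgebra_kernel]) auto
    then have "d (poly q (X 1)) = 0" by (simp add: q kernel_on_def)
    then have "X 0 ^ m * f = coeff q 0"
      using kernel_poly_slice[of q] q BK by auto
    then show "f \<in> ?B" using q(2) descend by metis
  qed
qed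

end

section \<open>Saturation by a monomial special fibre\<close>

text \<open>The substitution \<open>x\<^sub>i = 0\<close> for \<open>i \<in> V\<close>, which drops all monomials containing such a variable.\<close>

definition zero_vars :: "nat set \<Rightarrow> 'k::comm_ring_1 mpoly \<Rightarrow> 'k mpoly" where
  "zero_vars V p = Poly_Mapping.mapp (\<lambda>m a. a when Poly_Mapping.keys m \<inter> V = {}) p"

lemma lookup_zero_vars:
  "Poly_Mapping.lookup (zero_vars V p) m
    = (Poly_Mapping.lookup p m when Poly_Mapping.keys m \<inter> V = {})"
  by (simp add: zero_vars_def lookup_mapp when_def in_keys_iff)

lemma zero_vars_add: "zero_vars V (p + q) = zero_vars V p + zero_vars V q"
  by (rule poly_mapping_eqI) (simp add: lookup_zero_vars lookup_add when_def)

lemma zero_vars_single: "zero_vars V (Poly_Mapping.single m a)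
    = (if Poly_Mapping.keys m \<inter> V = {} then Poly_Mapping.single m a else 0)"
  by (rule poly_mapping_eqI) (auto simp: lookup_zero_vars lookup_single when_def)

lemma zero_vars_Const: "zero_vars V (Const a) = Const a"
  by (simp add: Const_def zero_vars_single)

lemma zero_vars_X: "zero_vars V (X i) = (if i \<in> V then 0 else X i :: 'k::comm_ring_1 mpoly)"
  by (simp add: X_def zero_vars_single)

lemma ex_poly_ring: "\<exists>n. p \<in> poly_ring n"
proof
  show "p \<in> poly_ring (Max (insert 0 (\<Union>m\<in>Poly_Mapping.keys p. Poly_Mapping.keys m)))"
    by (auto simp: poly_ring_def intro!: Max_ge)
qed

lemma zero_vars_mult:
  fixes p q :: "'k::comm_ring_1 mpoly"
  shows "zero_vars V (p * q) = zero_vars V p * zero_vars V q"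
proof -
  obtain i j where "p \<in> poly_ring i" and q: "q \<in> poly_ring j"
    using ex_poly_ring by metis
  then show ?thesis
  proof (induction p rule: poly_ring_induct)
    case (single m a)
    from q show ?case
    proof (induction q rule: poly_ring_induct)
      case (single m' b)
      have "Poly_Mapping.keys (m + m') = Poly_Mapping.keys m \<union> Poly_Mapping.keys m'"
        by (auto simp: in_keys_iff lookup_add)
      then show ?case by (auto simp: mult_single zero_vars_single)
    qed (simp add: distrib_left zero_vars_add)
  qed (simp add: distrib_right zero_vars_add)
qed

lemma zero_vars_one: "zero_vars V 1 = (1 :: 'k::comm_ring_1 mpoly)"
  using zero_vars_Const[of V 1] by (simp add: Const_def)

lemma zero_vars_numeral: "zero_vars V (numeral k) = (numeral k :: 'k::comm_ring_1 mpoly)"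
  using zero_vars_Const[of V "numeral k"] by (simp add: Const_def)

lemma zero_vars_uminus: "zero_vars V (- p) = - (zero_vars V p :: 'k::comm_ring_1 mpoly)"
  by (rule poly_mapping_eqI) (simp add: lookup_zero_vars when_def)

lemma zero_vars_diff: "zero_vars V (p - q) = zero_vars V p - (zero_vars V q :: 'k::comm_ring_1 mpoly)"
  by (rule poly_mapping_eqI) (simp add: lookup_zero_vars lookup_minus when_def)

lemma zero_vars_power: "zero_vars V (p ^ k) = (zero_vars V p :: 'k::comm_ring_1 mpoly) ^ k"
  by (induction k) (simp_all add: zero_vars_one zero_vars_mult)

lemma zero_vars_sum: "zero_vars V (sum f I) = (\<Sum>i\<in>I. zero_vars V (f i :: 'k::comm_ring_1 mpoly))"
  using zero_vars_Const[of V 0]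
  by (induction I rule: infinite_finite_induct) (simp_all add: zero_vars_add Const_def)

lemmas zero_vars_simps = zero_vars_add zero_vars_mult zero_vars_one zero_vars_numeral
  zero_vars_uminus zero_vars_diff zero_vars_power zero_vars_X

interpretation mpoly: module "\<lambda>a p. Const a * (p :: 'k::comm_ring_1 mpoly)"
  by unfold_locales
    (simp_all add: Const_def mult_single single_add algebra_simps flip: mult.assoc)

text \<open>The premises on products give \<open>B = span E + x\<^sub>0 B\<close> for the algebra \<open>B\<close> generated by \<open>S\<close>, and
  those on \<open>\<nu>\<close> and \<open>\<beta>\<close> make the substitution, which kills \<open>x\<^sub>0\<close>, injective on \<open>span E\<close>. So if \<open>x\<^sub>0 f = e + x\<^sub>0 b\<close>
  is such a decomposition, then \<open>e = 0\<close> and \<open>f = b\<close>.\<close>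

lemma saturated_if_monomial_fibre:
  fixes S :: "'k::field_char_0 mpoly set" and g :: "'i \<Rightarrow> 'k mpoly" and J :: "'i set"
    and \<nu> :: "'i \<Rightarrow> (nat \<Rightarrow>\<^sub>0 nat)" and \<beta> :: "'i \<Rightarrow> 'k"
  defines "E \<equiv> g ` J"
  assumes t: "X 0 \<in> S" and S: "S \<subseteq> insert (X 0) E"
    and E: "E \<subseteq> generated_subalgebra S" and one: "1 \<in> E"
    and prod: "\<And>e e'. e \<in> E \<Longrightarrow> e' \<in> E \<Longrightarrow>
      \<exists>e''\<in>E. \<exists>b\<in>generated_subalgebra S. e * e' = e'' + X 0 * b"
    and V: "0 \<in> V"
    and fibre_J: "\<And>j. j \<in> J \<Longrightarrow> zero_vars V (g j) = Poly_Mapping.single (\<nu> j) (\<beta> j)"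
    and nonzero: "\<And>j. j \<in> J \<Longrightarrow> \<beta> j \<noteq> 0"
    and inj_J: "inj_on \<nu> J"
    and f: "X 0 * f \<in> generated_subalgebra S"
  shows "f \<in> generated_subalgebra S"
proof -
  \<comment> \<open>The span is a set of sums over elements of \<open>E\<close>, so exponents and scalars are transported from
    the index set \<open>J\<close> to \<open>E\<close>.\<close>
  let ?B = "generated_subalgebra S"
  let ?t = "X 0 :: 'k mpoly"
  define \<mu> where "\<mu> e = \<nu> (inv_into J g e)" for e
  define \<alpha> where "\<alpha> e = \<beta> (inv_into J g e)" for e
  have fibre: "zero_vars V e = Poly_Mapping.single (\<mu> e) (\<alpha> e) \<and> \<alpha> e \<noteq> 0" if "e \<in> E" for e
    using that fibre_J[OF inv_into_into[of e g J]] nonzero[OF inv_into_into[of e g J]]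
    unfolding E_def \<mu>_def \<alpha>_def by (simp only: f_inv_into_f) blast
  have inj: "inj_on \<mu> E"
  proof (rule inj_onI)
    fix e e' assume e: "e \<in> E" "e' \<in> E" and "\<mu> e = \<mu> e'"
    then have "inv_into J g e = inv_into J g e'"
      using inj_J unfolding E_def \<mu>_def by (intro inj_onD[OF inj_J] inv_into_into)
    then show "e = e'" using e f_inv_into_f unfolding E_def by metis
  qed
  let ?W = "{e + ?t * b | e b. e \<in> mpoly.span E \<and> b \<in> ?B}"
  note B = subalgebra_generated[of S]
  note B_intros = subalgebra_intros[OF B]
  have span_B: "mpoly.span E \<subseteq> ?B"
    using E by (rule mpoly.span_minimal) (auto simp: mpoly.subspace_def intro: B_intros)
  have t_B: "?t \<in> ?B" using t by (rule generated_base)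
  have W_I: "p \<in> ?W" if "p = e + ?t * b" "e \<in> mpoly.span E" "b \<in> ?B" for p e b
    using that by blast
  have W_add: "p + q \<in> ?W" if W: "p \<in> ?W" "q \<in> ?W" for p q
  proof -
    from W obtain e b e' b' where *: "p = e + ?t * b" "q = e' + ?t * b'"
      "e \<in> mpoly.span E" "b \<in> ?B" "e' \<in> mpoly.span E" "b' \<in> ?B" by blast
    show ?thesis
    proof (rule W_I)
      show "p + q = (e + e') + ?t * (b + b')" by (simp add: * algebra_simps)
    qed (use * in \<open>auto intro: mpoly.span_add B_intros\<close>)
  qed
  have W_t: "?t * b \<in> ?W" if "b \<in> ?B" for b
    by (rule W_I[of _ 0 b]) (use that in \<open>auto intro: mpoly.span_zero\<close>)
  have W_scale: "Const a * p \<in> ?W" if "p \<in> ?W" for a p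
  proof -
    from that obtain e b where *: "p = e + ?t * b" "e \<in> mpoly.span E" "b \<in> ?B" by blast
    show ?thesis
    proof (rule W_I)
      show "Const a * p = Const a * e + ?t * (Const a * b)" by (simp add: * algebra_simps)
    qed (use * in \<open>auto intro: mpoly.span_scale B_intros\<close>)
  qed
  have W_zero: "0 \<in> ?W" using W_t[of 0] by (simp add: B_intros)
  have W_prod: "p * q \<in> ?W" if p: "p \<in> mpoly.span E" and q: "q \<in> mpoly.span E" for p q
    using p
  proof (induction p rule: mpoly.span_induct_alt)
    case base
    show ?case using W_zero by simp
  next
    case (step a e p)
    have "e * q \<in> ?W" using q
    proof (induction q rule: mpoly.span_induct_alt)
      case base
      show ?case using W_zero by simp
    next
      case (step a' e' q)
      obtain e'' b where "e'' \<in> E" "b \<in> ?B" "e * e' = e'' + ?t * b"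
        using prod[OF \<open>e \<in> E\<close> step.hyps] by blast
      then have "e * e' \<in> ?W" by (intro W_I[OF _ mpoly.span_base])
      then have "Const a' * (e * e') + e * q \<in> ?W"
        using step by (intro W_add W_scale)
      then show ?case by (simp add: algebra_simps)
    qed
    then have "Const a * (e * q) + p * q \<in> ?W"
      using step by (intro W_add W_scale)
    then show ?case by (simp add: algebra_simps)
  qed
  have "subalgebra ?W"
    unfolding subalgebra_def
  proof (intro conjI allI ballI)
    fix a
    show "Const a \<in> ?W"
      using W_scale[OF W_I[of 1 1 0], of a] mpoly.span_base[OF one] by (simp add: B_intros)
  next
    fix p q assume "p \<in> ?W" "q \<in> ?W"
    then show "p + q \<in> ?W" by (rule W_add)
    from \<open>p \<in> ?W\<close> \<open>q \<in> ?W\<close> obtain e b e' b' where *: "p = e + ?t * b" "q = e' + ?t * b'"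
      "e \<in> mpoly.span E" "b \<in> ?B" "e' \<in> mpoly.span E" "b' \<in> ?B" by blast
    have "e * e' + ?t * (e * b' + b * (e' + ?t * b')) \<in> ?W"
      using * span_B t_B by (intro W_add W_prod W_t B_intros) auto
    then show "p * q \<in> ?W" by (simp add: * algebra_simps)
  qed
  moreover have "S \<subseteq> ?W"
  proof
    fix s assume "s \<in> S"
    then consider "s = X 0" | "s \<in> E" using S by blast
    then show "s \<in> ?W"
    proof cases
      case 1
      then show ?thesis using W_t[OF subalgebra_one[OF B]] by simp
    next
      case 2
      show ?thesis
        by (rule W_I[of _ s 0]) (use 2 in \<open>auto intro: mpoly.span_base B_intros\<close>)
    qed
  qed
  ultimately have "?B \<subseteq> ?W" by (intro generated_minimal)
  then obtain e b where eb: "?t * f = e + ?t * b" "e \<in> mpoly.span E" "b \<in> ?B"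
    using f by blast
  from eb(2) obtain F r where F: "finite F" "F \<subseteq> E" "e = (\<Sum>u\<in>F. Const (r u) * u)"
    unfolding mpoly.span_explicit by blast
  have "zero_vars V e = 0"
  proof -
    have "e = ?t * (f - b)" using eb(1) by (simp add: algebra_simps)
    then show ?thesis using V by (simp add: zero_vars_mult zero_vars_X)
  qed
  moreover have "zero_vars V e = (\<Sum>u\<in>F. Poly_Mapping.single (\<mu> u) (r u * \<alpha> u))"
    using fibre F(2) unfolding F(3) zero_vars_sum
    by (intro sum.cong) (auto simp: zero_vars_mult zero_vars_Const Const_mult_single subset_eq)
  ultimately have eq0: "(\<Sum>u\<in>F. Poly_Mapping.single (\<mu> u) (r u * \<alpha> u)) = 0" by simp
  have "r v = 0" if v: "v \<in> F" for v
  proof -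
    have "0 = Poly_Mapping.lookup (\<Sum>u\<in>F. Poly_Mapping.single (\<mu> u) (r u * \<alpha> u)) (\<mu> v)"
      using eq0 by simp
    also have "\<dots> = (\<Sum>u\<in>F. if u = v then r v * \<alpha> v else 0)"
      unfolding lookup_sum using v F(2) inj
      by (intro sum.cong) (auto simp: lookup_single when_def dest: inj_onD)
    also have "\<dots> = r v * \<alpha> v" using v F(1) by simp
    finally show ?thesis using fibre v F(2) by auto
  qed
  then have "e = 0" by (simp add: F(3) Const_def)
  then have "?t * (f - b) = 0" using eb(1) by (simp add: algebra_simps)
  moreover have "?t \<noteq> 0"
    by (metis X_def lookup_single_eq lookup_zero zero_neq_one)
  ultimately show ?thesis using eb(3) by simp
qed

section \<open>The four kernels\<close>

text \<open>Monomials in \<open>x\<^sub>1, x\<^sub>3, x\<^sub>4\<close> are all that is left of the generators after \<open>x\<^sub>0 = x\<^sub>2 = 0\<close>.\<close>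

lemma Const_mult_X_powers:
  "Const a * (X 1 ^ p * X 3 ^ q * X 4 ^ r) = Poly_Mapping.single
    (Poly_Mapping.single 1 p + Poly_Mapping.single 3 q + Poly_Mapping.single 4 r)
    (a :: 'k::comm_ring_1)"
  by (simp add: X_power mult_single Const_def)

lemma exponents_eq_iff:
  "(Poly_Mapping.single 1 p + Poly_Mapping.single 3 q + Poly_Mapping.single 4 r :: nat \<Rightarrow>\<^sub>0 nat)
     = Poly_Mapping.single 1 p' + Poly_Mapping.single 3 q' + Poly_Mapping.single 4 r'
   \<longleftrightarrow> p = p' \<and> q = q' \<and> r = r'" (is "?m = ?m' \<longleftrightarrow> ?eq")
proof
  assume "?m = ?m'"
  then have "Poly_Mapping.lookup ?m i = Poly_Mapping.lookup ?m' i" for i by simp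
  from this[of 1] this[of 3] this[of 4] show ?eq
    by (simp add: lookup_add lookup_single)
qed simp

lemma Const_mult: "Const (a * b) = Const a * (Const b :: 'k::comm_ring_1 mpoly)"
  by (simp add: Const_def mult_single)

lemma Const_numeral: "Const (numeral k) = (numeral k :: 'k::comm_ring_1 mpoly)"
  and Const_uminus: "Const (- a) = - (Const a :: 'k mpoly)"
  and Const_one: "Const 1 = (1 :: 'k mpoly)"
  by (simp_all add: Const_def single_uminus)

lemma Const_power: "Const (a ^ k) = (Const a :: 'k::comm_ring_1 mpoly) ^ k"
  by (induction k) (simp_all add: Const_mult Const_one)

lemmas Const_simps = Const_power Const_mult Const_numeral Const_uminus Const_one

text \<open>The quadratic generator \<open>y\<close> and the cubic generator \<open>z\<close> parametrize a cusp modulo \<open>x\<^sub>0\<close>, so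
  that powers of \<open>z\<close> beyond the first can be traded for powers of \<open>y\<close>.\<close>

lemma cusp_products:
  fixes y z w :: "'k::comm_ring_1 mpoly"
  assumes B: "subalgebra B" and "y \<in> B" "w \<in> B" "M \<subseteq> B"
    and M: "\<And>m m'. m \<in> M \<Longrightarrow> m' \<in> M \<Longrightarrow> m * m' \<in> M"
    and cusp: "z ^ 2 = y ^ 3 + X 0 * w"
    and E: "E = {y ^ i * z ^ \<epsilon> * m | i \<epsilon> m. \<epsilon> \<le> (1::nat) \<and> m \<in> M}"
    and e: "e \<in> E" "e' \<in> E"
  shows "\<exists>e''\<in>E. \<exists>b\<in>B. e * e' = e'' + X 0 * b"
proof -
  from e obtain i \<epsilon> m i' \<epsilon>' m' where *: "e = y ^ i * z ^ \<epsilon> * m" "\<epsilon> \<le> 1" "m \<in> M"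
    "e' = y ^ i' * z ^ \<epsilon>' * m'" "\<epsilon>' \<le> 1" "m' \<in> M"
    unfolding E by blast
  have mm: "m * m' \<in> M" using * M by blast
  have prod: "e * e' = y ^ (i + i') * z ^ (\<epsilon> + \<epsilon>') * (m * m')"
    by (simp add: * power_add ac_simps)
  show ?thesis
  proof (cases "\<epsilon> + \<epsilon>' \<le> 1")
    case True
    then have "e * e' \<in> E" unfolding prod E using mm by blast
    moreover have "e * e' = e * e' + X 0 * 0" by simp
    ultimately show ?thesis using subalgebra_zero[OF B] by blast
  next
    case False
    then have "\<epsilon> + \<epsilon>' = 2" using * by simp
    then have "e * e' = y ^ (i + i' + 3) * z ^ 0 * (m * m') + X 0 * (w * y ^ (i + i') * (m * m'))"
      using cusp unfolding prod by (simp add: power_add algebra_simps)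
    moreover have "y ^ (i + i' + 3) * z ^ 0 * (m * m') \<in> E" unfolding E using mm by blast
    moreover have "w * y ^ (i + i') * (m * m') \<in> B"
      using assms(2-4) mm
      by (intro subalgebra_mult[OF B _ subsetD[OF \<open>M \<subseteq> B\<close>]] subalgebra_mult[OF B, of w]
          subalgebra_power[OF B])
    ultimately show ?thesis by blast
  qed
qed

text \<open>Up to the identity \<open>y\<^sup>3 = z\<^sup>2\<close> there is no coincidence among the monomials \<open>y\<^sup>i z\<^sup>\<epsilon>\<close> with
  \<open>y = x\<^sub>1\<^sup>2\<close>, \<open>z = x\<^sub>1\<^sup>3\<close>: the parity of the exponent determines \<open>\<epsilon> \<le> 1\<close>.\<close>

lemma cusp_exponents:
  assumes "2 * i + 3 * \<epsilon> = 2 * i' + 3 * \<epsilon>'" "\<epsilon> \<le> (1::nat)" "\<epsilon>' \<le> 1"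
  shows "i = i' \<and> \<epsilon> = \<epsilon>'"
proof -
  have "even \<epsilon> \<longleftrightarrow> even \<epsilon>'"
    using arg_cong[OF assms(1), of even] by simp
  then have "\<epsilon> = \<epsilon>'" using assms(2,3) by (auto simp: le_Suc_eq)
  then show ?thesis using assms(1) by simp
qed

lemma kernel_1:
  assumes "weitzenboeck_derivation 1 (d :: 'k::field_char_0 mpoly \<Rightarrow> 'k mpoly)"
  shows "kernel_on (poly_ring 1) d = generated_subalgebra {X 0}"
proof -
  interpret weitzenboeck 1 d using assms by unfold_locales auto
  show ?thesis
  proof (rule kernel_eq_generated)
    show "{X 0} \<subseteq> K" by (simp add: kernel_on_def d_X0 X_in_poly_ring)
  next
    fix A :: "'k mpoly set" and i :: nat
    assume "{X 0} \<subseteq> A" "X 1 \<in> A" "i \<le> 1"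
    then show "X i \<in> A" by (cases "i = 0") (auto simp: le_Suc_eq)
  next
    fix f :: "'k mpoly" assume "X 0 * f \<in> generated_subalgebra {X 0}"
    note B = subalgebra_intros[OF subalgebra_generated[of "{X 0 :: 'k mpoly}"]]
    show "f \<in> generated_subalgebra {X 0}"
    proof (rule saturated_if_monomial_fibre[where J = "{()}" and g = "\<lambda>_. 1" and V = "{0}"
          and \<nu> = "\<lambda>_. 0" and \<beta> = "\<lambda>_. 1"])
      fix e e' :: "'k mpoly" assume "e \<in> (\<lambda>_. 1) ` {()}" "e' \<in> (\<lambda>_. 1) ` {()}"
      then have "e * e' = 1 + X 0 * 0" by simp
      then show "\<exists>e''\<in>(\<lambda>_. 1) ` {()}. \<exists>b\<in>generated_subalgebra {X 0}. e * e' = e'' + X 0 * b"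
        using B(4) by blast
    qed (use B(5) in \<open>auto simp: zero_vars_one \<open>X 0 * f \<in> _\<close>\<close>)
  qed auto
qed

text \<open>Modulo \<open>x\<^sub>0\<close> the powers of \<open>y\<close> are, up to sign, distinct powers of \<open>x\<^sub>1\<close>.\<close>

lemma kernel_2:
  fixes d :: "'k::field_char_0 mpoly \<Rightarrow> 'k mpoly"
  assumes "weitzenboeck_derivation 2 d"
  defines "y \<equiv> 2 * X 0 * X 2 - X 1 ^ 2"
  shows "kernel_on (poly_ring 2) d = generated_subalgebra {X 0, y}"
proof -
  interpret weitzenboeck 2 d using assms by unfold_locales auto
  have [simp]: "X i \<in> R" if "i \<le> 2" for i using that by (rule X_in_poly_ring)
  show ?thesis
  proof (rule kernel_eq_generated)
    have "y \<in> R" unfolding y_def by (intro R_intros) auto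
    moreover have "d y = 0"
      by (simp add: y_def d_simps R_intros power2_eq_square)
    ultimately show "{X 0, y} \<subseteq> K" by (simp add: kernel_on_def d_X0)
  next
    fix A :: "'k mpoly set" and i :: nat
    assume A: "subalgebra A" "{X 0, y} \<subseteq> A" "X 1 \<in> A" and "i \<le> 2"
      and sat: "\<And>f. X 0 * f \<in> A \<Longrightarrow> f \<in> A"
    have "2 * (X 0 * X 2) = y + X 1 ^ 2" by (simp add: y_def)
    moreover have "y + X 1 ^ 2 \<in> A" using A by (intro subalgebra_intros[OF A(1)]) auto
    ultimately have "X 2 \<in> A" using sat subalgebra_cancel_numeral[OF A(1)] by metis
    moreover from \<open>i \<le> 2\<close> have "i = 0 \<or> i = 1 \<or> i = 2" by auto
    ultimately show "X i \<in> A" using A by auto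
  next
    fix f assume f: "X 0 * f \<in> generated_subalgebra {X 0, y}"
    let ?B = "generated_subalgebra {X 0, y}"
    note B = subalgebra_intros[OF subalgebra_generated[of "{X 0, y}"]]
    have y_B: "y \<in> ?B" by (rule generated_base) simp
    show "f \<in> ?B"
    proof (rule saturated_if_monomial_fibre[OF _ _ _ _ _ _ _ _ _ f, where J = UNIV
          and g = "\<lambda>i. y ^ i" and V = "{0}" and \<beta> = "\<lambda>i. (- 1) ^ i"
          and \<nu> = "\<lambda>i. Poly_Mapping.single 1 (2 * i) + Poly_Mapping.single 3 0
            + Poly_Mapping.single 4 0"])
      have "y = y ^ 1" by simp
      then show "{X 0, y} \<subseteq> insert (X 0) (range (\<lambda>i. y ^ i))" by blast
      show "range (\<lambda>i. y ^ i) \<subseteq> ?B" using y_B by (auto intro: B)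
      have "1 = y ^ 0" by simp
      then show "1 \<in> range (\<lambda>i. y ^ i)" by blast
    next
      fix e e' assume "e \<in> range (\<lambda>i. y ^ i)" "e' \<in> range (\<lambda>i. y ^ i)"
      then obtain i j where "e = y ^ i" "e' = y ^ j" by blast
      then have "e * e' = y ^ (i + j) + X 0 * 0" by (simp add: power_add)
      then show "\<exists>e''\<in>range (\<lambda>i. y ^ i). \<exists>b\<in>?B. e * e' = e'' + X 0 * b"
        using B(4) by blast
    next
      fix i :: nat
      have "zero_vars {0} (y ^ i) = (- (X 1 ^ 2)) ^ i"
        by (simp add: y_def zero_vars_simps)
      also have "\<dots> = Const ((- 1) ^ i) * (X 1 ^ (2 * i) * X 3 ^ 0 * X 4 ^ 0)"
        by (subst power_minus) (simp add: Const_simps flip: power_mult)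
      finally show "zero_vars {0} (y ^ i) = Poly_Mapping.single (Poly_Mapping.single 1 (2 * i)
          + Poly_Mapping.single 3 0 + Poly_Mapping.single 4 0) ((- 1) ^ i)"
        by (simp only: Const_mult_X_powers)
    next
      show "inj (\<lambda>i. Poly_Mapping.single 1 (2 * i) + Poly_Mapping.single 3 0
          + Poly_Mapping.single 4 0 :: nat \<Rightarrow>\<^sub>0 nat)"
        by (rule injI, unfold exponents_eq_iff) simp
    qed auto
  qed auto
qed

text \<open>The products \<open>y\<^sup>i z\<^sup>\<epsilon> c\<^sup>k\<close> with \<open>\<epsilon> \<le> 1\<close> have the special fibres
  \<open>6\<^sup>k x\<^sub>1\<^bsup>2i+3\<epsilon>+3k\<^esup> x\<^sub>3\<^sup>k\<close>: the exponent of \<open>x\<^sub>3\<close> recovers \<open>k\<close>.\<close>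

lemma kernel_3:
  fixes d :: "'k::field_char_0 mpoly \<Rightarrow> 'k mpoly"
  assumes "weitzenboeck_derivation 3 d"
  defines "y \<equiv> - 2 * X 0 * X 2 + X 1 ^ 2"
    and "z \<equiv> - 3 * X 0 * X 1 * X 2 + 3 * X 0 ^ 2 * X 3 + X 1 ^ 3"
    and "c \<equiv> - 18 * X 0 * X 1 * X 2 * X 3 + 8 * X 0 * X 2 ^ 3 + 9 * X 3 ^ 2 * X 0 ^ 2
              + 6 * X 1 ^ 3 * X 3 - 3 * X 1 ^ 2 * X 2 ^ 2"
  shows "kernel_on (poly_ring 3) d = generated_subalgebra {X 0, y, z, c}"
proof -
  interpret weitzenboeck 3 d using assms by unfold_locales auto
  have [simp]: "X i \<in> R" if "i \<le> 3" for i using that by (rule X_in_poly_ring)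
  have cusp: "z ^ 2 = y ^ 3 + X 0 * (X 0 * c)"
    unfolding y_def z_def c_def by algebra
  show ?thesis
  proof (rule kernel_eq_generated)
    have "y \<in> R" "z \<in> R" "c \<in> R"
      unfolding y_def z_def c_def by (intro R_intros; simp)+
    moreover have "d y = 0" "d z = 0" "d c = 0"
      unfolding y_def z_def c_def
      by (simp_all add: d_simps R_intros power2_eq_square power3_eq_cube algebra_simps)
    ultimately show "{X 0, y, z, c} \<subseteq> K" by (simp add: kernel_on_def d_X0)
  next
    fix A :: "'k mpoly set" and i :: nat
    assume A: "subalgebra A" "{X 0, y, z, c} \<subseteq> A" "X 1 \<in> A" and "i \<le> 3"
      and sat: "\<And>f. X 0 * f \<in> A \<Longrightarrow> f \<in> A"
    have "2 * (X 0 * X 2) = X 1 ^ 2 - y" by (simp add: y_def)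
    moreover have "X 1 ^ 2 - y \<in> A" using A by (intro subalgebra_intros[OF A(1)]) auto
    ultimately have X2: "X 2 \<in> A" using sat subalgebra_cancel_numeral[OF A(1)] by metis
    have "3 * (X 0 * (X 0 * X 3)) = z + 3 * X 0 * X 1 * X 2 - X 1 ^ 3"
      by (simp add: z_def power2_eq_square)
    moreover have "z + 3 * X 0 * X 1 * X 2 - X 1 ^ 3 \<in> A"
      using A X2 by (intro subalgebra_intros[OF A(1)]) auto
    ultimately have "X 3 \<in> A" using sat subalgebra_cancel_numeral[OF A(1)] by metis
    moreover from \<open>i \<le> 3\<close> have "i = 0 \<or> i = 1 \<or> i = 2 \<or> i = 3" by auto
    ultimately show "X i \<in> A" using A X2 by auto
  next
    fix f assume f: "X 0 * f \<in> generated_subalgebra {X 0, y, z, c}"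
    let ?B = "generated_subalgebra {X 0, y, z, c}"
    let ?J = "{(i, \<epsilon>, j). \<epsilon> \<le> (1::nat)} :: (nat \<times> nat \<times> nat) set"
    let ?g = "\<lambda>(i, \<epsilon>, j). y ^ i * z ^ \<epsilon> * c ^ j"
    let ?\<nu> = "\<lambda>(i, \<epsilon>, j). Poly_Mapping.single 1 (2 * i + 3 * \<epsilon> + 3 * j)
      + Poly_Mapping.single 3 j + Poly_Mapping.single 4 0 :: nat \<Rightarrow>\<^sub>0 nat"
    note B = subalgebra_intros[OF subalgebra_generated[of "{X 0, y, z, c}"]]
    have gens: "X 0 \<in> ?B" "y \<in> ?B" "z \<in> ?B" "c \<in> ?B" by (auto intro: generated_base)
    have E: "?g ` ?J = {y ^ i * z ^ \<epsilon> * m | i \<epsilon> m. \<epsilon> \<le> 1 \<and> m \<in> range (\<lambda>j. c ^ j)}"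
      by (auto simp: image_iff; blast)
    show "f \<in> ?B"
    proof (rule saturated_if_monomial_fibre[OF _ _ _ _ _ _ _ _ _ f, where J = ?J and g = ?g
          and V = "{0, 2}" and \<nu> = ?\<nu> and \<beta> = "\<lambda>(i, \<epsilon>, j). 6 ^ j"])
      have "y = ?g (1, 0, 0)" "z = ?g (0, 1, 0)" "c = ?g (0, 0, 1)" by simp_all
      then show "{X 0, y, z, c} \<subseteq> insert (X 0) (?g ` ?J)" by blast
      show "?g ` ?J \<subseteq> ?B" using gens by (auto intro!: B)
      have "1 = ?g (0, 0, 0)" by simp
      then show "1 \<in> ?g ` ?J" by blast
    next
      fix e e' assume "e \<in> ?g ` ?J" "e' \<in> ?g ` ?J"
      then show "\<exists>e''\<in>?g ` ?J. \<exists>b\<in>?B. e * e' = e'' + X 0 * b"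
        using gens by (intro cusp_products[OF subalgebra_generated _ _ _ _ cusp E])
          (auto intro: B simp flip: power_add)
    next
      fix j assume "j \<in> ?J"
      obtain i \<epsilon> k where j: "j = (i, \<epsilon>, k)" by (cases j)
      have "zero_vars {0, 2} (?g j) = (X 1 ^ 2) ^ i * (X 1 ^ 3) ^ \<epsilon> * (6 * X 1 ^ 3 * X 3) ^ k"
        by (simp add: j y_def z_def c_def zero_vars_simps)
      also have "\<dots> = Const (6 ^ k) * (X 1 ^ (2 * i + 3 * \<epsilon> + 3 * k) * X 3 ^ k * X 4 ^ 0)"
        unfolding power_mult_distrib by (simp add: Const_simps power_add ac_simps flip: power_mult)
      finally show "zero_vars {0, 2} (?g j) = Poly_Mapping.single (?\<nu> j) (case j of (i, \<epsilon>, j) \<Rightarrow> 6 ^ j)"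
        by (simp only: Const_mult_X_powers j prod.case)
    next
      show "inj_on ?\<nu> ?J"
      proof (rule inj_onI)
        fix j j' assume J: "j \<in> ?J" "j' \<in> ?J" and eq: "?\<nu> j = ?\<nu> j'"
        obtain i \<epsilon> k i' \<epsilon>' k' where j: "j = (i, \<epsilon>, k)" "j' = (i', \<epsilon>', k')"
          by (cases j, cases j')
        have le: "\<epsilon> \<le> 1" "\<epsilon>' \<le> 1" using J by (simp_all add: j)
        from eq have "2 * i + 3 * \<epsilon> = 2 * i' + 3 * \<epsilon>' \<and> k = k'"
          unfolding j prod.case exponents_eq_iff by auto
        then show "j = j'" using cusp_exponents[OF _ le, of i i'] by (simp add: j)
      qed
    qed auto
  qed auto
qed

text \<open>The generator \<open>c\<close> of the previous case is \<open>3 y u - x\<^sub>0 v\<close> here. The products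
  \<open>y\<^sup>i z\<^sup>\<epsilon> u\<^sup>a v\<^sup>b\<close> with \<open>\<epsilon> \<le> 1\<close> have distinct fibres, because \<open>u\<close> contributes \<open>2 x\<^sub>1 x\<^sub>3\<close> and
  \<open>v\<close> contributes \<open>-6 x\<^sub>1\<^sup>2 x\<^sub>4\<close>.\<close>

lemma kernel_4:
  fixes d :: "'k::field_char_0 mpoly \<Rightarrow> 'k mpoly"
  assumes "weitzenboeck_derivation 4 d"
  defines "y \<equiv> - 2 * X 0 * X 2 + X 1 ^ 2"
    and "u \<equiv> - 2 * X 0 * X 4 + 2 * X 1 * X 3 - X 2 ^ 2"
    and "z \<equiv> - 3 * X 0 * X 1 * X 2 + 3 * X 3 * X 0 ^ 2 + X 1 ^ 3"
    and "v \<equiv> 12 * X 2 * X 0 * X 4 - 9 * X 3 ^ 2 * X 0 - 6 * X 1 ^ 2 * X 4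
              + 6 * X 1 * X 2 * X 3 - 2 * X 2 ^ 3"
  shows "kernel_on (poly_ring 4) d = generated_subalgebra {X 0, y, u, z, v}"
proof -
  interpret weitzenboeck 4 d using assms by unfold_locales auto
  have [simp]: "X i \<in> R" if "i \<le> 4" for i using that by (rule X_in_poly_ring)
  have cusp: "z ^ 2 = y ^ 3 + X 0 * (X 0 * (3 * y * u - X 0 * v))"
    unfolding y_def z_def u_def v_def by algebra
  show ?thesis
  proof (rule kernel_eq_generated)
    have "y \<in> R" "z \<in> R" "u \<in> R" "v \<in> R"
      unfolding y_def z_def u_def v_def by (intro R_intros; simp)+
    moreover have "d y = 0" "d z = 0" "d u = 0" "d v = 0"
      unfolding y_def z_def u_def v_def
      by (simp_all add: d_simps R_intros power2_eq_square power3_eq_cube algebra_simps)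
    ultimately show "{X 0, y, u, z, v} \<subseteq> K" by (simp add: kernel_on_def d_X0)
  next
    fix A :: "'k mpoly set" and i :: nat
    assume A: "subalgebra A" "{X 0, y, u, z, v} \<subseteq> A" "X 1 \<in> A" and "i \<le> 4"
      and sat: "\<And>f. X 0 * f \<in> A \<Longrightarrow> f \<in> A"
    have "2 * (X 0 * X 2) = X 1 ^ 2 - y" by (simp add: y_def)
    moreover have "X 1 ^ 2 - y \<in> A" using A by (intro subalgebra_intros[OF A(1)]) auto
    ultimately have X2: "X 2 \<in> A" using sat subalgebra_cancel_numeral[OF A(1)] by metis
    have "3 * (X 0 * (X 0 * X 3)) = z + 3 * X 0 * X 1 * X 2 - X 1 ^ 3"
      by (simp add: z_def power2_eq_square)
    moreover have "z + 3 * X 0 * X 1 * X 2 - X 1 ^ 3 \<in> A"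
      using A X2 by (intro subalgebra_intros[OF A(1)]) auto
    ultimately have X3: "X 3 \<in> A" using sat subalgebra_cancel_numeral[OF A(1)] by metis
    have "2 * (X 0 * X 4) = 2 * X 1 * X 3 - X 2 ^ 2 - u" by (simp add: u_def)
    moreover have "2 * X 1 * X 3 - X 2 ^ 2 - u \<in> A"
      using A X2 X3 by (intro subalgebra_intros[OF A(1)]) auto
    ultimately have "X 4 \<in> A" using sat subalgebra_cancel_numeral[OF A(1)] by metis
    moreover from \<open>i \<le> 4\<close> have "i = 0 \<or> i = 1 \<or> i = 2 \<or> i = 3 \<or> i = 4" by auto
    ultimately show "X i \<in> A" using A X2 X3 by auto
  next
    fix f assume f: "X 0 * f \<in> generated_subalgebra {X 0, y, u, z, v}"
    let ?B = "generated_subalgebra {X 0, y, u, z, v}"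
    let ?J = "{(i, \<epsilon>, a, b). \<epsilon> \<le> (1::nat)} :: (nat \<times> nat \<times> nat \<times> nat) set"
    let ?g = "\<lambda>(i, \<epsilon>, a, b). y ^ i * z ^ \<epsilon> * (u ^ a * v ^ b)"
    let ?\<nu> = "\<lambda>(i, \<epsilon>, a, b). Poly_Mapping.single 1 (2 * i + 3 * \<epsilon> + a + 2 * b)
      + Poly_Mapping.single 3 a + Poly_Mapping.single 4 b :: nat \<Rightarrow>\<^sub>0 nat"
    let ?\<beta> = "\<lambda>(i :: nat, \<epsilon> :: nat, a, b). 2 ^ a * (- 6) ^ b :: 'k"
    let ?M = "{u ^ a * v ^ b | a b. True}"
    note B = subalgebra_intros[OF subalgebra_generated[of "{X 0, y, u, z, v}"]]
    have gens: "X 0 \<in> ?B" "y \<in> ?B" "z \<in> ?B" "u \<in> ?B" "v \<in> ?B" by (auto intro: generated_base)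
    have E: "?g ` ?J = {y ^ i * z ^ \<epsilon> * m | i \<epsilon> m. \<epsilon> \<le> 1 \<and> m \<in> ?M}"
      by (auto simp: image_iff; blast)
    have M: "m * m' \<in> ?M" if "m \<in> ?M" "m' \<in> ?M" for m m'
    proof -
      from that obtain a b a' b' where "m = u ^ a * v ^ b" "m' = u ^ a' * v ^ b'" by blast
      then have "m * m' = u ^ (a + a') * v ^ (b + b')" by (simp add: power_add ac_simps)
      then show ?thesis by blast
    qed
    show "f \<in> ?B"
    proof (rule saturated_if_monomial_fibre[OF _ _ _ _ _ _ _ _ _ f, where J = ?J and g = ?g
          and V = "{0, 2}" and \<nu> = ?\<nu> and \<beta> = ?\<beta>])
      have "y = ?g (1, 0, 0, 0)" "z = ?g (0, 1, 0, 0)" "u = ?g (0, 0, 1, 0)" "v = ?g (0, 0, 0, 1)"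
        by simp_all
      then show "{X 0, y, u, z, v} \<subseteq> insert (X 0) (?g ` ?J)" by blast
      show "?g ` ?J \<subseteq> ?B" using gens by (auto intro!: B)
      have "1 = ?g (0, 0, 0, 0)" by simp
      then show "1 \<in> ?g ` ?J" by blast
    next
      fix e e' assume "e \<in> ?g ` ?J" "e' \<in> ?g ` ?J"
      then show "\<exists>e''\<in>?g ` ?J. \<exists>b\<in>?B. e * e' = e'' + X 0 * b"
        using gens by (intro cusp_products[OF subalgebra_generated _ _ _ M cusp E])
          (auto intro!: B)
    next
      fix j assume "j \<in> ?J"
      obtain i \<epsilon> a b where j: "j = (i, \<epsilon>, a, b)" by (cases j)
      have "zero_vars {0, 2} (?g j) = (X 1 ^ 2) ^ i * (X 1 ^ 3) ^ \<epsilon>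
          * ((2 * X 1 * X 3) ^ a * ((- 6) * X 1 ^ 2 * X 4) ^ b)"
        by (simp add: j y_def z_def u_def v_def zero_vars_simps)
      also have "\<dots> = Const (2 ^ a * (- 6) ^ b)
          * (X 1 ^ (2 * i + 3 * \<epsilon> + a + 2 * b) * X 3 ^ a * X 4 ^ b)"
        unfolding power_mult_distrib
        by (simp add: Const_simps power_add ac_simps flip: power_mult)
      finally show "zero_vars {0, 2} (?g j) = Poly_Mapping.single (?\<nu> j) (?\<beta> j)"
        by (simp only: Const_mult_X_powers j prod.case)
    next
      show "inj_on ?\<nu> ?J"
      proof (rule inj_onI)
        fix j j' assume J: "j \<in> ?J" "j' \<in> ?J" and eq: "?\<nu> j = ?\<nu> j'"
        obtain i \<epsilon> a b i' \<epsilon>' a' b' where j: "j = (i, \<epsilon>, a, b)" "j' = (i', \<epsilon>', a', b')"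
          by (cases j, cases j')
        have le: "\<epsilon> \<le> 1" "\<epsilon>' \<le> 1" using J by (simp_all add: j)
        from eq have "2 * i + 3 * \<epsilon> = 2 * i' + 3 * \<epsilon>' \<and> a = a' \<and> b = b'"
          unfolding j prod.case exponents_eq_iff by auto
        then show "j = j'" using cusp_exponents[OF _ le, of i i'] by (simp add: j)
      qed
    qed auto
  qed auto
qed

theorem mainTheorem10:
  fixes n :: nat
    and d :: "'k::field_char_0 mpoly \<Rightarrow> 'k mpoly"
    and t x1 x2 x3 x4 :: "'k mpoly"
  assumes "n \<ge> 1"
    and "weitzenboeck_derivation n d"
    and "t = X 0" and "x1 = X 1" and "x2 = X 2" and "x3 = X 3" and "x4 = X 4"
  shows
    "(n = 1 \<longrightarrow> kernel_on (poly_ring n) d = generated_subalgebra {t})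
   \<and> (n = 2 \<longrightarrow>
       (let dv = 2 * t * x2 - x1^2
        in kernel_on (poly_ring n) d = generated_subalgebra {t, dv}))
   \<and> (n = 3 \<longrightarrow>
       (let dv = - 2 * t * x2 + x1^2;
            tr = - 3 * t * x1 * x2 + 3 * t^2 * x3 + x1^3;
            c = - 18 * t * x1 * x2 * x3 + 8 * t * x2^3 + 9 * x3^2 * t^2
                + 6 * x1^3 * x3 - 3 * x1^2 * x2^2
        in kernel_on (poly_ring n) d = generated_subalgebra {t, dv, tr, c}))
   \<and> (n = 4 \<longrightarrow>
       (let d1 = - 2 * t * x2 + x1^2;
            d2 = - 2 * t * x4 + 2 * x1 * x3 - x2^2;
            tr1 = - 3 * t * x1 * x2 + 3 * x3 * t^2 + x1^3;
            tr2 = 12 * x2 * t * x4 - 9 * x3^2 * t - 6 * x1^2 * x4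
                  + 6 * x1 * x2 * x3 - 2 * x2^3
        in kernel_on (poly_ring n) d = generated_subalgebra {t, d1, d2, tr1, tr2}))"
  using assms kernel_1[of d] kernel_2[of d] kernel_3[of d] kernel_4[of d]
  by (auto simp: Let_def)

end
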